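(* Let $a,b\geq 0$ be real numbers and let $c=(a+b+1)/2$. If $(c-1)^2\leq 2ab$, then $$(x^c+y^c)^2 \geq (x+y)(x^ay^b+y^ax^b)$$ for all real $x,y\geq 0$, and equality occurs if and only if $x=y$ or $\{a,b\}=\{0,1\}$.
   Context: Powers are real powers of nonnegative real numbers, with the convention $0^0=1$ (and $0^s=0$ for $s>0$). *)

theory Defs
  imports Complex_Main
begin

text \<open>Real power of a nonnegative real with the convention \<open>0\<^sup>0 = 1\<close>; the library's
  \<open>powr\<close> cannot be used directly because \<open>0 powr 0 = 0\<close> there.
  Only nonnegative bases are meaningful.\<close>

definition rpow :: "real \<Rightarrow> real \<Rightarrow> real" where
  "rpow x s = (if x = 0 \<and> s = 0 then 1 else x powr s)"

end

theory Submission
  imports Defs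
begin

text \<open>
  If \<open>x\<close> or \<open>y\<close> vanishes, the claim can be read off. For \<open>x, y > 0\<close> let
  \<open>x = exp (u + t)\<close> and \<open>y = exp (u - t)\<close>. The exponents are chosen so that both sides are
  homogeneous of degree \<open>2 c = a + b + 1\<close>; dividing by \<open>4 exp (2 c u)\<close> therefore removes \<open>u\<close>
  and leaves \<open>cosh (c t)\<^sup>2 \<ge> cosh t * cosh (d t)\<close> with \<open>d = a - b\<close>.

  Put \<open>p = (1 + d) / 2\<close> and \<open>q = (1 - d) / 2\<close>. The product formula for \<open>cosh\<close> followed by
  \<open>cosh (2 z) = 1 + 2 sinh (z)\<^sup>2\<close> turns this into
  \<open>sinh (p t)\<^sup>2 + sinh (q t)\<^sup>2 \<le> sinh (c t)\<^sup>2\<close>, and the hypothesis \<open>(c - 1)\<^sup>2 \<le> 2 a b\<close> is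
  exactly \<open>p\<^sup>2 + q\<^sup>2 \<le> c\<^sup>2\<close>. The inequality thus says that squared hyperbolic sines are
  superadditive in the squares of their arguments (lemma \<open>sinh_squared_superadditive\<close>), which
  holds because \<open>sinh z / z\<close> is increasing for \<open>z > 0\<close>. Strict monotonicity
  also gives the equality cases: for \<open>t \<noteq> 0\<close> one needs \<open>p = 0\<close> or \<open>q = 0\<close> and
  \<open>p\<^sup>2 + q\<^sup>2 = c\<^sup>2\<close>, which means \<open>d = \<plusminus>1\<close> and \<open>c = 1\<close>, that is, \<open>{a, b} = {0, 1}\<close>.
\<close>

section \<open>Growth of the hyperbolic sine\<close>

text \<open>
  This is the strict monotonicity of \<open>sinh z / z\<close>. By the mean value theorem the slope of
  \<open>sinh\<close> over \<open>[0, y]\<close> is a value of \<open>cosh\<close> to the left of \<open>y\<close>, and the slope over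
  \<open>[y, x]\<close> is a value to the right of \<open>y\<close>, hence larger.
\<close>

lemma sinh_over_self_strict_mono:
  fixes x y :: real
  assumes "0 < y" "y < x"
  shows "x * sinh y < y * sinh x"
proof -
  have deriv: "(sinh has_real_derivative cosh z) (at z)" for z :: real
    by (auto intro!: derivative_eq_intros)
  obtain l where l: "0 < l" "l < y" "sinh y - sinh 0 = (y - 0) * cosh l"
    using MVT2[of 0 y sinh cosh] assms deriv by blast
  obtain r where r: "y < r" "r < x" "sinh x - sinh y = (x - y) * cosh r"
    using MVT2[of y x sinh cosh] assms deriv by blast
  have "cosh l < cosh r"
    using l r by (intro cosh_real_strict_mono) auto
  hence "(x - y) * y * cosh l < (x - y) * y * cosh r"
    using assms by simp
  moreover have "(x - y) * sinh y = (x - y) * y * cosh l"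
    using l by simp
  moreover have "y * (sinh x - sinh y) = (x - y) * y * cosh r"
    using r by simp
  ultimately show ?thesis
    by (simp add: algebra_simps)
qed

lemma sinh_abs_squared: "sinh \<bar>x::real\<bar> ^ 2 = sinh x ^ 2"
  by (simp add: abs_if)

text \<open>
  Squaring makes the monotonicity of \<open>sinh z / z\<close> independent of signs.
\<close>

lemma sinh_squared_strict_ratio:
  fixes p r :: real
  assumes "p \<noteq> 0" "\<bar>p\<bar> < \<bar>r\<bar>"
  shows "r\<^sup>2 * (sinh p)\<^sup>2 < p\<^sup>2 * (sinh r)\<^sup>2"
proof -
  have "(\<bar>r\<bar> * sinh \<bar>p\<bar>)\<^sup>2 < (\<bar>p\<bar> * sinh \<bar>r\<bar>)\<^sup>2"
    using sinh_over_self_strict_mono[of "\<bar>p\<bar>" "\<bar>r\<bar>"] assms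
    by (intro power_strict_mono) auto
  thus ?thesis
    by (simp add: power_mult_distrib sinh_abs_squared)
qed

text \<open>
  At the endpoints \<open>p = 0\<close> and \<open>\<bar>p\<bar> = \<bar>r\<bar>\<close> the strict comparison degenerates to an equality.
\<close>

lemma sinh_squared_ratio:
  fixes p r :: real
  assumes "\<bar>p\<bar> \<le> \<bar>r\<bar>"
  shows "r\<^sup>2 * (sinh p)\<^sup>2 \<le> p\<^sup>2 * (sinh r)\<^sup>2"
proof (cases "p = 0 \<or> \<bar>p\<bar> = \<bar>r\<bar>")
  case True
  moreover have "r\<^sup>2 * (sinh p)\<^sup>2 = p\<^sup>2 * (sinh r)\<^sup>2" if "\<bar>p\<bar> = \<bar>r\<bar>"
    using that by (metis power2_abs sinh_abs_squared)
  ultimately show ?thesis by auto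
next
  case False
  thus ?thesis using sinh_squared_strict_ratio[of p r] assms by simp
qed

text \<open>
  Bounding \<open>(sinh p / p)\<^sup>2\<close> and \<open>(sinh q / q)\<^sup>2\<close> by \<open>(sinh r / r)\<^sup>2\<close> and adding gives
  \<open>sinh (p)\<^sup>2 + sinh (q)\<^sup>2 \<le> (p\<^sup>2 + q\<^sup>2) (sinh r / r)\<^sup>2\<close>. If \<open>p\<close> and \<open>q\<close> are both nonzero, each
  is smaller than \<open>r\<close> in absolute value, so that bound is strict.
\<close>

lemma sinh_squared_superadditive:
  fixes p q r :: real
  assumes "p\<^sup>2 + q\<^sup>2 \<le> r\<^sup>2"
  shows "(sinh p)\<^sup>2 + (sinh q)\<^sup>2 \<le> (sinh r)\<^sup>2"
    and "(sinh p)\<^sup>2 + (sinh q)\<^sup>2 = (sinh r)\<^sup>2 \<longleftrightarrow> (p = 0 \<or> q = 0) \<and> p\<^sup>2 + q\<^sup>2 = r\<^sup>2"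
proof -
  let ?S = "(sinh p)\<^sup>2 + (sinh q)\<^sup>2"
  have "?S \<le> (sinh r)\<^sup>2 \<and>
    (?S = (sinh r)\<^sup>2 \<longleftrightarrow> (p = 0 \<or> q = 0) \<and> p\<^sup>2 + q\<^sup>2 = r\<^sup>2)"
  proof (cases "r = 0")
    case True
    hence "p = 0" "q = 0"
      using assms by (auto simp: sum_power2_le_zero_iff)
    thus ?thesis using True by simp
  next
    case False
    hence r2: "r\<^sup>2 > 0" and sr: "(sinh r)\<^sup>2 > 0" by auto
    have "p\<^sup>2 \<le> r\<^sup>2" "q\<^sup>2 \<le> r\<^sup>2"
      using assms zero_le_power2[of p] zero_le_power2[of q] by linarith+
    hence le: "\<bar>p\<bar> \<le> \<bar>r\<bar>" "\<bar>q\<bar> \<le> \<bar>r\<bar>"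
      by (simp_all add: abs_le_square_iff)
    have sum_le: "r\<^sup>2 * ?S \<le> (p\<^sup>2 + q\<^sup>2) * (sinh r)\<^sup>2"
      using sinh_squared_ratio[OF le(1)] sinh_squared_ratio[OF le(2)]
      by (simp add: algebra_simps)
    have scale_le: "(p\<^sup>2 + q\<^sup>2) * (sinh r)\<^sup>2 \<le> r\<^sup>2 * (sinh r)\<^sup>2"
      using assms by (intro mult_right_mono) auto
    have ineq: "?S \<le> (sinh r)\<^sup>2"
      using sum_le scale_le r2 by (meson mult_le_cancel_left_pos order_trans)
    have strict: "?S < (sinh r)\<^sup>2" if "p \<noteq> 0" "q \<noteq> 0"
    proof -
      have "p\<^sup>2 < r\<^sup>2"
        using assms that zero_less_power2[of q] by linarith
      hence "\<bar>p\<bar> < \<bar>r\<bar>"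
        by (meson abs_le_square_iff not_le)
      hence "r\<^sup>2 * ?S < (p\<^sup>2 + q\<^sup>2) * (sinh r)\<^sup>2"
        using sinh_squared_strict_ratio[OF \<open>p \<noteq> 0\<close>] sinh_squared_ratio[OF le(2)]
        by (simp add: algebra_simps add_less_le_mono)
      hence "r\<^sup>2 * ?S < r\<^sup>2 * (sinh r)\<^sup>2"
        using scale_le by linarith
      thus ?thesis using r2 by simp
    qed
    have tight: "p\<^sup>2 + q\<^sup>2 = r\<^sup>2" if "?S = (sinh r)\<^sup>2"
    proof -
      have "(p\<^sup>2 + q\<^sup>2) * (sinh r)\<^sup>2 = r\<^sup>2 * (sinh r)\<^sup>2"
        using scale_le sum_le unfolding that by (rule order_antisym)
      thus ?thesis using sr by simp
    qed
    have conv: "?S = (sinh r)\<^sup>2" if "p = 0 \<or> q = 0" "p\<^sup>2 + q\<^sup>2 = r\<^sup>2"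
    proof -
      have "p = 0 \<and> \<bar>q\<bar> = \<bar>r\<bar> \<or> q = 0 \<and> \<bar>p\<bar> = \<bar>r\<bar>"
        using that by (auto simp: power2_eq_iff abs_eq_iff)
      thus ?thesis
        by (metis add.left_neutral add.right_neutral sinh_0 sinh_abs_squared zero_power2)
    qed
    show ?thesis
      using ineq strict tight conv by (metis less_irrefl)
  qed
  thus "?S \<le> (sinh r)\<^sup>2"
    and "?S = (sinh r)\<^sup>2 \<longleftrightarrow> (p = 0 \<or> q = 0) \<and> p\<^sup>2 + q\<^sup>2 = r\<^sup>2"
    by blast+
qed

lemma cosh_times_cosh_eq_sinh_squared:
  fixes s t :: real
  shows "cosh s * cosh t = 1 + (sinh ((s + t) / 2))\<^sup>2 + (sinh ((s - t) / 2))\<^sup>2"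
proof -
  have double: "cosh z = 1 + 2 * (sinh (z / 2))\<^sup>2" for z :: real
    using cosh_double[of "z / 2"] cosh_square_eq[of "z / 2"] by simp
  have "2 * (cosh s * cosh t) = cosh (s + t) + cosh (s - t)"
    by (simp add: cosh_add cosh_diff)
  thus ?thesis
    using double[of "s + t"] double[of "s - t"] by simp
qed

section \<open>Reduction of the power inequality\<close>

text \<open>
  In the variables \<open>u\<close> (logarithm of the geometric mean) and \<open>t\<close> (half the logarithm of the
  quotient) the gap between the two sides has the sign of a difference of squared hyperbolic
  sines, since the factor depending on \<open>u\<close> is positive and common to both sides.
\<close>

lemma power_gap_eq_sinh_gap:
  fixes a b c u t :: real
  assumes "2 * c = a + b + 1"
  defines "x \<equiv> exp (u + t)" and "y \<equiv> exp (u - t)"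
  shows "(x powr c + y powr c)\<^sup>2 - (x + y) * (x powr a * y powr b + y powr a * x powr b)
    = 4 * exp (2 * c * u) *
      ((sinh (c * t))\<^sup>2 - ((sinh ((1 + (a - b)) / 2 * t))\<^sup>2 + (sinh ((1 - (a - b)) / 2 * t))\<^sup>2))"
proof -
  have split: "exp (v + z) + exp (v - z) = 2 * exp v * cosh z" for v z :: real
    by (simp add: cosh_def exp_add exp_diff exp_minus field_simps)
  have "x powr c + y powr c = exp (c * u + c * t) + exp (c * u - c * t)"
    by (simp add: x_def y_def powr_def algebra_simps)
  hence pc: "x powr c + y powr c = 2 * exp (c * u) * cosh (c * t)"
    by (simp only: split)
  have p1: "x + y = 2 * exp u * cosh t"
    by (simp only: x_def y_def split)
  have "x powr a * y powr b + y powr a * x powr b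
      = exp ((a + b) * u + (a - b) * t) + exp ((a + b) * u - (a - b) * t)"
    by (simp add: x_def y_def powr_def algebra_simps flip: exp_add)
  hence pab: "x powr a * y powr b + y powr a * x powr b
      = 2 * exp ((a + b) * u) * cosh ((a - b) * t)"
    by (simp only: split)
  have ec: "(exp (c * u))\<^sup>2 = exp (2 * c * u)"
    by (simp add: power2_eq_square flip: exp_add)
  have "u + (a + b) * u = (a + b + 1) * u"
    by (simp add: algebra_simps)
  hence eab: "exp u * exp ((a + b) * u) = exp (2 * c * u)"
    by (simp only: assms(1) flip: exp_add)
  have args: "(t + (a - b) * t) / 2 = (1 + (a - b)) / 2 * t"
    "(t - (a - b) * t) / 2 = (1 - (a - b)) / 2 * t"
    by (simp_all add: algebra_simps)
  have "(x powr c + y powr c)\<^sup>2 = 4 * exp (2 * c * u) * (cosh (c * t))\<^sup>2"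
    by (simp add: pc power_mult_distrib ec)
  moreover have "(x + y) * (x powr a * y powr b + y powr a * x powr b)
      = 4 * (exp u * exp ((a + b) * u)) * (cosh t * cosh ((a - b) * t))"
    by (simp add: p1 pab)
  ultimately show ?thesis
    by (simp only: eab cosh_times_cosh_eq_sinh_squared args cosh_square_eq)
      (simp add: algebra_simps)
qed

lemma power_inequality_pos:
  fixes a b c x y :: real
  assumes c: "2 * c = a + b + 1" and nonneg: "a \<ge> 0" "b \<ge> 0"
    and cond: "(c - 1)\<^sup>2 \<le> 2 * a * b" and pos: "x > 0" "y > 0"
  shows "(x + y) * (x powr a * y powr b + y powr a * x powr b) \<le> (x powr c + y powr c)\<^sup>2"
    and "(x powr c + y powr c)\<^sup>2 = (x + y) * (x powr a * y powr b + y powr a * x powr b)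
      \<longleftrightarrow> x = y \<or> {a, b} = {0, 1}"
proof -
  define u where "u = (ln x + ln y) / 2"
  define t where "t = (ln x - ln y) / 2"
  define p where "p = (1 + (a - b)) / 2"
  define q where "q = (1 - (a - b)) / 2"
  let ?gap = "(sinh (c * t))\<^sup>2 - ((sinh (p * t))\<^sup>2 + (sinh (q * t))\<^sup>2)"
  have "u + t = ln x" "u - t = ln y"
    by (simp_all add: u_def t_def field_simps)
  hence xy: "exp (u + t) = x" "exp (u - t) = y"
    using pos by simp_all
  have gap: "(x powr c + y powr c)\<^sup>2 - (x + y) * (x powr a * y powr b + y powr a * x powr b)
      = 4 * exp (2 * c * u) * ?gap"
    using power_gap_eq_sinh_gap[OF c, of u t] unfolding xy p_def q_def .
  have t0: "t = 0 \<longleftrightarrow> x = y"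
    using pos by (simp add: t_def)
  have cc: "c = (a + b + 1) / 2"
    using c by simp
  have "c\<^sup>2 - (p\<^sup>2 + q\<^sup>2) = (2 * a * b - (c - 1)\<^sup>2)"
    unfolding cc p_def q_def by (simp add: power2_eq_square field_simps)
  hence pq: "p\<^sup>2 + q\<^sup>2 \<le> c\<^sup>2"
    using cond by linarith
  hence "(p\<^sup>2 + q\<^sup>2) * t\<^sup>2 \<le> c\<^sup>2 * t\<^sup>2"
    by (intro mult_right_mono) auto
  hence pqt: "(p * t)\<^sup>2 + (q * t)\<^sup>2 \<le> (c * t)\<^sup>2"
    by (simp add: algebra_simps power_mult_distrib)
  have "0 \<le> ?gap"
    using sinh_squared_superadditive(1)[OF pqt] by simp
  hence "0 \<le> 4 * exp (2 * c * u) * ?gap"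
    by simp
  thus "(x + y) * (x powr a * y powr b + y powr a * x powr b) \<le> (x powr c + y powr c)\<^sup>2"
    using gap by linarith
  have extremal: "(p = 0 \<or> q = 0) \<and> p\<^sup>2 + q\<^sup>2 = c\<^sup>2 \<longleftrightarrow> {a, b} = {0, 1}"
  proof
    assume L: "(p = 0 \<or> q = 0) \<and> p\<^sup>2 + q\<^sup>2 = c\<^sup>2"
    \<comment> \<open>As \<open>p + q = 1\<close>, one of them being \<open>0\<close> forces \<open>p\<^sup>2 + q\<^sup>2 = 1\<close>.\<close>
    have "p + q = 1"
      by (simp add: p_def q_def field_simps)
    hence "c\<^sup>2 = 1"
      using L by auto
    moreover have "c \<ge> 0"
      using cc nonneg by simp
    ultimately have "c = 1"
      by (simp add: power2_eq_1_iff)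
    hence "a + b = 1"
      using c by simp
    moreover have "b = a + 1 \<or> a = b + 1"
      using L by (auto simp: p_def q_def)
    ultimately show "{a, b} = {0, 1}"
      by (auto simp: doubleton_eq_iff)
  next
    assume "{a, b} = {0, 1}"
    thus "(p = 0 \<or> q = 0) \<and> p\<^sup>2 + q\<^sup>2 = c\<^sup>2"
      by (auto simp: doubleton_eq_iff p_def q_def cc)
  qed
  have "(x powr c + y powr c)\<^sup>2 = (x + y) * (x powr a * y powr b + y powr a * x powr b)
      \<longleftrightarrow> 4 * exp (2 * c * u) * ?gap = 0"
    using gap by linarith
  also have "\<dots> \<longleftrightarrow> (sinh (p * t))\<^sup>2 + (sinh (q * t))\<^sup>2 = (sinh (c * t))\<^sup>2"
    by auto
  also have "\<dots> \<longleftrightarrow> (p * t = 0 \<or> q * t = 0) \<and> (p * t)\<^sup>2 + (q * t)\<^sup>2 = (c * t)\<^sup>2"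
    by (rule sinh_squared_superadditive(2)[OF pqt])
  also have "\<dots> \<longleftrightarrow> t = 0 \<or> (p = 0 \<or> q = 0) \<and> p\<^sup>2 + q\<^sup>2 = c\<^sup>2"
    by (auto simp: power_mult_distrib simp flip: distrib_right)
  finally show "(x powr c + y powr c)\<^sup>2 = (x + y) * (x powr a * y powr b + y powr a * x powr b)
      \<longleftrightarrow> x = y \<or> {a, b} = {0, 1}"
    by (simp only: t0 extremal)
qed

text \<open>
  On the boundary the convention for \<open>0\<^sup>0\<close> matters only if \<open>a\<close> or \<open>b\<close> is \<open>0\<close>, and then the
  hypothesis reads \<open>(c - 1)\<^sup>2 \<le> 0\<close>, so that \<open>{a, b} = {0, 1}\<close> and both sides are \<open>(x + y)\<^sup>2\<close>.
  Otherwise the right-hand side vanishes as soon as one variable does, while the left-hand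
  side, because \<open>c > 0\<close>, vanishes only if both do.
\<close>

theorem theorem5:
  fixes a b c :: real
  assumes "a \<ge> 0" and "b \<ge> 0"
    and "c = (a + b + 1) / 2"
    and "(c - 1)^2 \<le> 2 * a * b"
  shows "\<forall>x y. x \<ge> 0 \<and> y \<ge> 0 \<longrightarrow>
    (rpow x c + rpow y c)^2 \<ge> (x + y) * (rpow x a * rpow y b + rpow y a * rpow x b) \<and>
    ((rpow x c + rpow y c)^2 = (x + y) * (rpow x a * rpow y b + rpow y a * rpow x b)
      \<longleftrightarrow> x = y \<or> {a, b} = {0, 1})"
proof (intro allI impI, elim conjE)
  fix x y :: real
  assume x: "x \<ge> 0" and y: "y \<ge> 0"
  let ?L = "(rpow x c + rpow y c)\<^sup>2"
  let ?R = "(x + y) * (rpow x a * rpow y b + rpow y a * rpow x b)"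
  have c: "2 * c = a + b + 1" and "c > 0"
    using assms by simp_all
  consider (exceptional) "{a, b} = {0, 1}"
    | (interior) "x > 0" "y > 0"
    | (boundary) "{a, b} \<noteq> {0, 1}" "x = 0 \<or> y = 0"
    using x y by fastforce
  thus "?L \<ge> ?R \<and> (?L = ?R \<longleftrightarrow> x = y \<or> {a, b} = {0, 1})"
  proof cases
    case exceptional
    hence "c = 1"
      using c by (auto simp: doubleton_eq_iff)
    hence "?L = ?R"
      using exceptional x y by (auto simp: doubleton_eq_iff rpow_def power2_eq_square)
    thus ?thesis using exceptional by simp
  next
    case interior
    thus ?thesis
      using power_inequality_pos[OF c assms(1,2,4) interior] by (simp add: rpow_def)
  next
    case boundary
    have "a \<noteq> 0 \<and> b \<noteq> 0"
    proof (rule ccontr)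
      assume zero: "\<not> (a \<noteq> 0 \<and> b \<noteq> 0)"
      hence "c = 1" using assms(4) by auto
      hence "{a, b} = {0, 1}" using c zero by (auto simp: doubleton_eq_iff)
      thus False using boundary by simp
    qed
    hence "?R = 0" and "?L = 0 \<longleftrightarrow> x = y"
      using boundary(2) \<open>c > 0\<close> by (auto simp: rpow_def)
    thus ?thesis using boundary(1) by auto
  qed
qed

end
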